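(* Let $\mathbb F$ be a field of characteristic $p\geq 3$, let $(L,[\cdot,\cdot],(\cdot)^{[p]})$ be a restricted Lie algebra over $\mathbb F$, and let $(m_t,\omega_t)$, with $m_t=\sum_{i\ge 0}t^i m_i$ and $\omega_t=\sum_{i\geq 0}t^i\omega_i$, be a restricted formal deformation of $(L,[\cdot,\cdot],(\cdot)^{[p]})$. Then $(m_1,\omega_1)$ is a $2$-cocycle of the restricted cohomology of $L$ with adjoint coefficients, that is, $(m_1,\omega_1)\in C^2_*(L,L)$, $d^2_{CE}m_1=0$ and $\mathrm{ind}^2(m_1,\omega_1)=0$.
   Context: Restricted Lie algebra over a field $\mathbb F$ of characteristic $p$: a Lie algebra $L$ with a map $(\cdot)^{[p]}:L\to L$ such that $(\lambda x)^{[p]}=\lambda^p x^{[p]}$; $[x,y^{[p]}]=[[\cdots[x,y],y],\cdots,y]$ ($p$ copies of $y$); $(x+y)^{[p]}=x^{[p]}+y^{[p]}+\sum_{i=1}^{p-1}s_i(x,y)$, where $i\,s_i(x,y)$ is the coefficient of $Z^{i-1}$ in $\mathrm{ad}^{p-1}_{Zx+y}(x)$. Notation: $[x_1,\dots,x_n]:=[[\cdots[x_1,x_2],x_3],\cdots,x_n]$ (for $n=1$ this is $x_1$). $L$ acts on itself by $x\cdot m=[x,m]$. Chevalley–Eilenberg cochains: $C^n_{CE}(L,L)$ is the space of alternating $n$-linear maps $L^n\to L$, and $d^2_{CE}\varphi(x,y,z)=-\varphi([x,y],z)+\varphi([x,z],y)-\varphi([y,z],x)+[x,\varphi(y,z)]-[y,\varphi(x,z)]+[z,\varphi(x,y)]$.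 $C^2_*(L,L)$ is the set of pairs $(\varphi,\omega)$ with $\varphi\in C^2_{CE}(L,L)$ and $\omega:L\to L$ a map having the $( * )$-property with respect to $\varphi$: for all $\lambda\in\mathbb F$, $x,y\in L$, $\omega(\lambda x)=\lambda^p\omega(x)$ and $$\omega(x+y)=\omega(x)+\omega(y)+\sum_{\substack{x_i\in\{x,y\}\\ x_1=x,\ x_2=y}}\frac1{\sharp\{x\}}\sum_{k=0}^{p-2}(-1)^k\,x_p\cdot x_{p-1}\cdots x_{p-k+1}\cdot\varphi([x_1,\dots,x_{p-k-1}],x_{p-k}),$$ where the outer sum is over $p$-tuples $(x_1,\dots,x_p)$ of symbols in $\{x,y\}$ with $x_1=x,x_2=y$, and $\sharp\{x\}$ is the number of $x_i$ equal to $x$. For $(\alpha,\beta)\in C^2_*(L,L)$, $\mathrm{ind}^2(\alpha,\beta):L\times L\to L$ is $\mathrm{ind}^2(\alpha,\beta)(x,y)=-\alpha(x,y^{[p]})+\sum_{i+j=p-1}(-1)^i\,\mathrm{ad}_y^i\big(\alpha([x,\underbrace{y,\dots,y}_{j}],y)\big)-[x,\beta(y)]$. A restricted $2$-cocycle is $(\alpha,\beta)\in C^2_*(L,L)$ with $d^2_{CE}\alpha=0$ and $\mathrm{ind}^2(\alpha,\beta)=0$. Restricted formal deformation of $L$: a pair of maps $m_t:L\times L\to L[[t]]$, $m_t=\sum_{i\ge0}t^im_i$, and $\omega_t:L\to L[[t]]$, $\omega_t=\sum_{i\ge0}t^i\omega_i$, with $m_0=[\cdot,\cdot]$, $\omega_0=(\cdot)^{[p]}$,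 $(m_i,\omega_i)\in C^2_*(L,L)$ for $i\ge1$, such that, $m_t$ being extended to $L[[t]]$ by $m_t(\sum_i t^ix_i,\sum_jt^jy_j)=\sum_{i,j}t^{i+j}m_t(x_i,y_j)$, for all $x,y,z\in L$: $m_t(x,m_t(y,z))+m_t(y,m_t(z,x))+m_t(z,m_t(x,y))=0$ and $m_t(x,\omega_t(y))=m_t(m_t(\cdots m_t(x,y),y),\cdots,y)$ ($p$ copies of $y$ on the right). *)

theory Defs
  imports "HOL-Computational_Algebra.Computational_Algebra"
begin

locale lie_algebra = vector_space scale
  for scale :: "'f::field \<Rightarrow> 'l::ab_group_add \<Rightarrow> 'l" (infixr \<open>*s\<close> 75) +
  fixes br :: "'l \<Rightarrow> 'l \<Rightarrow> 'l"
  assumes br_linear_right: "Vector_Spaces.linear scale scale (\<lambda>y. br x y)"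
    and br_linear_left: "Vector_Spaces.linear scale scale (\<lambda>x. br x y)"
    and br_self: "br x x = 0"
    and jacobi: "br x (br y z) + br y (br z x) + br z (br x y) = 0"
begin

text \<open>Left-normed brackets \<open>[x\<^sub>1, \<dots>, x\<^sub>n] = [[\<dots>[x\<^sub>1, x\<^sub>2], \<dots>], x\<^sub>n]\<close>; only used for nonempty lists.\<close>

definition left_normed :: "'l list \<Rightarrow> 'l" where
  "left_normed xs = foldl br (hd xs) (tl xs)"

text \<open>The \<open>\<F>[Z]\<close>-bilinear extension of the bracket to \<open>L[Z]\<close>, whose elements are
  represented by the library's polynomials with coefficients in \<open>L\<close>.\<close>

definition poly_br :: "'l poly \<Rightarrow> 'l poly \<Rightarrow> 'l poly" where
  "poly_br P Q = (\<Sum>i\<le>degree P. \<Sum>j\<le>degree Q. monom (br (coeff P i) (coeff Q j)) (i + j))"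

text \<open>\<open>i s\<^sub>i(x,y)\<close> is the coefficient of \<open>Z\<^sup>i\<^sup>-\<^sup>1\<close> in \<open>ad\<^sup>p\<^sup>-\<^sup>1\<close> of \<open>Zx + y\<close> applied to \<open>x\<close>; it is used
  for \<open>1 \<le> i < p\<close>, where \<open>i\<close> is invertible in characteristic \<open>p\<close>. The polynomial
  \<open>[:y, x:]\<close> is \<open>y + Zx\<close>.\<close>

definition jacobson_s :: "nat \<Rightarrow> nat \<Rightarrow> 'l \<Rightarrow> 'l \<Rightarrow> 'l" where
  "jacobson_s p i x y =
     inverse (of_nat i) *s coeff ((poly_br [:y, x:] ^^ (p - 1)) [:x:]) (i - 1)"

definition C2_CE :: "('l \<Rightarrow> 'l \<Rightarrow> 'l) set" where
  "C2_CE = {\<phi>. (\<forall>x. Vector_Spaces.linear scale scale (\<lambda>y. \<phi> x y)) \<and>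
                (\<forall>y. Vector_Spaces.linear scale scale (\<lambda>x. \<phi> x y)) \<and>
                (\<forall>x. \<phi> x x = 0)}"

definition d2_CE :: "('l \<Rightarrow> 'l \<Rightarrow> 'l) \<Rightarrow> 'l \<Rightarrow> 'l \<Rightarrow> 'l \<Rightarrow> 'l" where
  "d2_CE \<phi> x y z =
     - \<phi> (br x y) z + \<phi> (br x z) y - \<phi> (br y z) x
     + br x (\<phi> y z) - br y (\<phi> x z) + br z (\<phi> x y)"

end

locale restricted_lie_algebra = lie_algebra scale br
  for scale :: "'f::field \<Rightarrow> 'l::ab_group_add \<Rightarrow> 'l" (infixr \<open>*s\<close> 75)
    and br :: "'l \<Rightarrow> 'l \<Rightarrow> 'l" +
  fixes p :: nat and pmap :: "'l \<Rightarrow> 'l"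
  assumes prime_p: "prime p" and char_p: "CHAR('f) = p"
    and pmap_scale: "pmap (c *s x) = c ^ p *s pmap x"
    and br_pmap: "br x (pmap y) = left_normed (x # replicate p y)"
    and pmap_add: "pmap (x + y) = pmap x + pmap y + (\<Sum>i = 1..p - 1. jacobson_s p i x y)"
begin

text \<open>A word \<open>w\<close> of length \<open>p\<close> over \<open>bool\<close> encodes a tuple of symbols in \<open>{x, y}\<close>, with \<open>True\<close>
  for the symbol \<open>x\<close>, so that the symbols stay distinct even when \<open>x = y\<close> in \<open>L\<close>. Lists are
  indexed from \<open>0\<close>: with \<open>xs = [x\<^sub>1, \<dots>, x\<^sub>p]\<close>, the term \<open>x\<^sub>p\<^sub>-\<^sub>k\<close> is \<open>xs ! (p - k - 1)\<close>, and \<open>fold\<close> acts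
  with the elements of \<open>drop (p - k) xs\<close>, first \<open>x\<^sub>p\<^sub>-\<^sub>k\<^sub>+\<^sub>1\<close> and last \<open>x\<^sub>p\<close>.\<close>

definition star_words :: "bool list set" where
  "star_words = {w. length w = p \<and> w ! 0 = True \<and> w ! 1 = False}"

definition star_term :: "('l \<Rightarrow> 'l \<Rightarrow> 'l) \<Rightarrow> 'l list \<Rightarrow> 'l" where
  "star_term \<phi> xs =
     (\<Sum>k = 0..p - 2. (- 1) ^ k *s
        fold br (drop (p - k) xs) (\<phi> (left_normed (take (p - k - 1) xs)) (xs ! (p - k - 1))))"

definition star_property :: "('l \<Rightarrow> 'l \<Rightarrow> 'l) \<Rightarrow> ('l \<Rightarrow> 'l) \<Rightarrow> bool" where
  "star_property \<phi> \<omega> \<longleftrightarrow>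
     (\<forall>c x. \<omega> (c *s x) = c ^ p *s \<omega> x) \<and>
     (\<forall>x y. \<omega> (x + y) = \<omega> x + \<omega> y +
        (\<Sum>w\<in>star_words. inverse (of_nat (count_list w True)) *s
            star_term \<phi> (map (\<lambda>s. if s then x else y) w)))"

definition C2_star :: "(('l \<Rightarrow> 'l \<Rightarrow> 'l) \<times> ('l \<Rightarrow> 'l)) set" where
  "C2_star = {(\<phi>, \<omega>). \<phi> \<in> C2_CE \<and> star_property \<phi> \<omega>}"

definition ind2 :: "('l \<Rightarrow> 'l \<Rightarrow> 'l) \<Rightarrow> ('l \<Rightarrow> 'l) \<Rightarrow> 'l \<Rightarrow> 'l \<Rightarrow> 'l" where
  "ind2 \<alpha> \<beta> x y =
     - \<alpha> x (pmap y)
     + (\<Sum>(i, j) | i + j = p - 1.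
          (- 1) ^ i *s (br y ^^ i) (\<alpha> (left_normed (x # replicate j y)) y))
     - br x (\<beta> y)"

definition restricted_2_cocycles :: "(('l \<Rightarrow> 'l \<Rightarrow> 'l) \<times> ('l \<Rightarrow> 'l)) set" where
  "restricted_2_cocycles =
     {(\<alpha>, \<beta>) \<in> C2_star. (\<forall>x y z. d2_CE \<alpha> x y z = 0) \<and> (\<forall>x y. ind2 \<alpha> \<beta> x y = 0)}"

end

text \<open>The elements of \<open>L[[t]]\<close> are represented by the library's formal power series with
  coefficients in \<open>L\<close>, and \<open>fps_const\<close> embeds \<open>L\<close> into \<open>L[[t]]\<close>. The extension of
  \<open>m\<^sub>t : L \<times> L \<rightarrow> L[[t]]\<close> to \<open>L[[t]]\<close> collects the coefficient of \<open>t\<^sup>n\<close> in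
  the sum of all \<open>t\<^sup>i\<^sup>+\<^sup>j m\<^sub>t(x\<^sub>i, y\<^sub>j)\<close>.\<close>

definition fps_ext :: "('l \<Rightarrow> 'l \<Rightarrow> 'l fps) \<Rightarrow> 'l fps \<Rightarrow> 'l fps \<Rightarrow> 'l::ab_group_add fps" where
  "fps_ext mt X Y = Abs_fps (\<lambda>n. \<Sum>i\<le>n. \<Sum>j\<le>n - i. mt (X $ i) (Y $ j) $ (n - (i + j)))"

context restricted_lie_algebra
begin

definition restricted_deformation :: "('l \<Rightarrow> 'l \<Rightarrow> 'l fps) \<Rightarrow> ('l \<Rightarrow> 'l fps) \<Rightarrow> bool" where
  "restricted_deformation mt \<omega>t \<longleftrightarrow>
     (\<forall>x y. mt x y $ 0 = br x y) \<and>
     (\<forall>x. \<omega>t x $ 0 = pmap x) \<and>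
     (\<forall>i\<ge>1. ((\<lambda>x y. mt x y $ i), (\<lambda>x. \<omega>t x $ i)) \<in> C2_star) \<and>
     (\<forall>x y z. fps_ext mt (fps_const x) (mt y z) + fps_ext mt (fps_const y) (mt z x)
                + fps_ext mt (fps_const z) (mt x y) = 0) \<and>
     (\<forall>x y. fps_ext mt (fps_const x) (\<omega>t y) =
              ((\<lambda>u. fps_ext mt u (fps_const y)) ^^ p) (fps_const x))"

end

end

(* Both cocycle identities are the coefficients of t^1 in the two deformation equations. For the
   second one, set U_n = m_t(...m_t(x,y)...,y) with n copies of y; its coefficient of t^1 satisfies
   U_(n+1),1 = m_1(U_n,0, y) - ad_y(U_n,1), and unrolling this recursion gives the sum in ind^2. *)

theory Submission
  imports Defs
begin

lemma fps_ext_nth_0: "fps_ext mt X Y $ 0 = mt (X $ 0) (Y $ 0) $ 0"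
  by (simp add: fps_ext_def)

text \<open>When the shift t^(i+j) already supplies the factor t, only the constant term of
  \<open>mt\<close>, the bracket of a deformation, can contribute.\<close>

lemma fps_ext_nth_1:
  "fps_ext mt X Y $ 1 =
     mt (X $ 0) (Y $ 0) $ 1 + mt (X $ 0) (Y $ 1) $ 0 + mt (X $ 1) (Y $ 0) $ 0"
  by (simp add: fps_ext_def)

context lie_algebra
begin

lemma br_zero_left [simp]: "br 0 y = 0"
  by (rule module_hom.zero[OF Vector_Spaces.linear.axioms(3)[OF br_linear_left]])

lemma br_zero_right [simp]: "br x 0 = 0"
  by (rule module_hom.zero[OF Vector_Spaces.linear.axioms(3)[OF br_linear_right]])

lemma br_sum_right: "br x (\<Sum>i\<in>A. f i) = (\<Sum>i\<in>A. br x (f i))"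
  by (rule module_hom.sum[OF Vector_Spaces.linear.axioms(3)[OF br_linear_right]])

lemma br_scale_right: "br x (c *s y) = c *s br x y"
  by (rule module_hom.scale[OF Vector_Spaces.linear.axioms(3)[OF br_linear_right]])

lemma C2_CE_minus_right: "\<phi> \<in> C2_CE \<Longrightarrow> \<phi> x (- y) = - \<phi> x y"
  by (rule module_hom.neg[of scale scale]) (simp add: C2_CE_def Vector_Spaces.linear.axioms(3))

lemma C2_CE_skew:
  assumes "\<phi> \<in> C2_CE"
  shows "\<phi> x y = - \<phi> y x"
proof -
  have lin: "module_hom scale scale (\<lambda>y. \<phi> x y)" "module_hom scale scale (\<lambda>x. \<phi> x y)"
    and self: "\<phi> x x = 0" for x y
    using assms by (simp_all add: C2_CE_def Vector_Spaces.linear.axioms(3))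
  have "0 = \<phi> (x + y) (x + y)"
    by (simp add: self)
  also have "\<dots> = \<phi> x y + \<phi> y x"
    by (simp only: module_hom.add[OF lin(1)] module_hom.add[OF lin(2)]) (simp add: self)
  finally show ?thesis
    by (simp add: eq_neg_iff_add_eq_0)
qed

text \<open>Treating the bracket as a cochain lets skew-symmetry and sign rules be proved once, for
  it and for m_1.\<close>

lemma br_in_C2_CE: "br \<in> C2_CE"
  by (simp add: C2_CE_def br_linear_left br_linear_right br_self)

lemmas br_skew = C2_CE_skew[OF br_in_C2_CE]

lemma left_normed_replicate_Suc:
  "left_normed (x # replicate (Suc n) y) = br (left_normed (x # replicate n y)) y"
  \<comment> \<open>The extra y is moved from the front of the block to its end, where
    \<open>foldl\<close> brackets with it last.\<close>
  by (subst replicate_Suc, subst replicate_append_same[symmetric]) (simp add: left_normed_def)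

text \<open>The t^1 part of the deformed Jacobi identity is a cyclic sum; skew-symmetry brings the
  coboundary to the same shape.\<close>

lemma d2_CE_cyclic:
  assumes "\<phi> \<in> C2_CE"
  shows "d2_CE \<phi> x y z =
    (\<phi> x (br y z) + br x (\<phi> y z)) + (\<phi> y (br z x) + br y (\<phi> z x)) + (\<phi> z (br x y) + br z (\<phi> x y))"
proof -
  have "\<phi> (br x z) y = \<phi> y (br z x)"
    by (subst C2_CE_skew[OF assms], subst br_skew) (simp add: C2_CE_minus_right[OF assms])
  moreover have "br y (\<phi> x z) = - br y (\<phi> z x)"
    by (subst C2_CE_skew[OF assms]) (simp add: C2_CE_minus_right[OF br_in_C2_CE])
  moreover have "\<phi> (br x y) z = - \<phi> z (br x y)" "\<phi> (br y z) x = - \<phi> x (br y z)"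
    by (rule C2_CE_skew[OF assms])+
  ultimately show ?thesis
    by (simp add: d2_CE_def algebra_simps)
qed

context
  fixes mt :: "'l \<Rightarrow> 'l \<Rightarrow> 'l fps"
  assumes mt_nth_0: "\<And>x y. mt x y $ 0 = br x y"
begin

lemma fps_ext_funpow_nth_0:
  "((\<lambda>u. fps_ext mt u (fps_const y)) ^^ n) (fps_const x) $ 0 = left_normed (x # replicate n y)"
  by (induction n)
     (simp_all add: fps_ext_nth_0 mt_nth_0 left_normed_replicate_Suc left_normed_def[of "[x]"]
        del: replicate.simps(2))

text \<open>Term i has m_1 as the bracket used in iteration n - i + 1, the other n brackets being
  undeformed; each of the i later ones gives a sign when y moves to the left. Counting from
  \<open>Suc n\<close> makes n + 1 iterations match the n + 1 terms.\<close>

lemma fps_ext_funpow_nth_1: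
  assumes "(\<lambda>x y. mt x y $ 1) \<in> C2_CE"
  shows "((\<lambda>u. fps_ext mt u (fps_const y)) ^^ Suc n) (fps_const x) $ 1 =
    (\<Sum>i\<le>n. (- 1) ^ i *s (br y ^^ i) (mt (left_normed (x # replicate (n - i) y)) y $ 1))"
proof (induction n)
  case 0
  show ?case
    by (simp add: fps_ext_nth_1[unfolded One_nat_def] mt_nth_0 left_normed_def)
next
  case (Suc n)
  let ?U = "\<lambda>n. ((\<lambda>u. fps_ext mt u (fps_const y)) ^^ n) (fps_const x)"
  have "?U (Suc (Suc n)) $ 1 = mt (?U (Suc n) $ 0) y $ 1 + br (?U (Suc n) $ 1) y"
    \<comment> \<open>\<open>fps_const y\<close> has no t^1 part, so the middle term of
      \<open>fps_ext_nth_1\<close> is a bracket with 0.\<close>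
    by (subst funpow.simps) (simp only: o_apply fps_ext_nth_1, simp add: mt_nth_0)
  also have "br (?U (Suc n) $ 1) y = - br y (?U (Suc n) $ 1)"
    by (rule br_skew)
  also have "\<dots> = (\<Sum>i\<le>n. (- 1) ^ Suc i *s (br y ^^ Suc i)
      (mt (left_normed (x # replicate (n - i) y)) y $ 1))"
    unfolding Suc.IH by (simp add: br_sum_right br_scale_right sum_negf)
  finally show ?case
    \<comment> \<open>The term at i = 0 is the new value of m_1; the remaining ones are the
      induction hypothesis after -ad_y, shifted by one.\<close>
    unfolding fps_ext_funpow_nth_0 sum.atMost_Suc_shift by simp
qed

end

end

theorem theorem3p3:
  fixes scale :: "'f::field \<Rightarrow> 'l::ab_group_add \<Rightarrow> 'l"
    and br :: "'l \<Rightarrow> 'l \<Rightarrow> 'l" and p :: nat and pmap :: "'l \<Rightarrow> 'l"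
    and mt :: "'l \<Rightarrow> 'l \<Rightarrow> 'l fps" and \<omega>t :: "'l \<Rightarrow> 'l fps"
  assumes "restricted_lie_algebra scale br p pmap"
    and "p \<ge> 3"
    and "restricted_lie_algebra.restricted_deformation scale br p pmap mt \<omega>t"
  shows "((\<lambda>x y. fps_nth (mt x y) 1), (\<lambda>x. fps_nth (\<omega>t x) 1))
           \<in> restricted_lie_algebra.restricted_2_cocycles scale br p pmap"
proof -
  interpret restricted_lie_algebra scale br p pmap by fact
  let ?m = "\<lambda>x y. mt x y $ 1" and ?w = "\<lambda>x. \<omega>t x $ 1"
  have mt0: "mt x y $ 0 = br x y" and wt0: "\<omega>t x $ 0 = pmap x"
    and star: "(?m, ?w) \<in> C2_star"
    and jac: "fps_ext mt (fps_const x) (mt y z) + fps_ext mt (fps_const y) (mt z x)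
                + fps_ext mt (fps_const z) (mt x y) = 0"
    and pow: "fps_ext mt (fps_const x) (\<omega>t y) =
              ((\<lambda>u. fps_ext mt u (fps_const y)) ^^ p) (fps_const x)" for x y z
    using assms(3) by (simp_all add: restricted_deformation_def)
  have m: "?m \<in> C2_CE"
    using star by (simp add: C2_star_def)
  have ext1: "fps_ext mt (fps_const x) Y $ 1 = ?m x (Y $ 0) + br x (Y $ 1)" for x Y
    by (simp add: fps_ext_nth_1[unfolded One_nat_def] mt0)
  have "d2_CE ?m x y z = 0" for x y z
    using arg_cong[OF jac[of x y z], of "\<lambda>X. X $ 1"]
    unfolding d2_CE_cyclic[OF m] by (simp only: fps_add_nth fps_zero_nth ext1 mt0)
  moreover have "ind2 ?m ?w x y = 0" for x y
  proof -
    let ?g = "\<lambda>i j. scale ((- 1) ^ i) ((br y ^^ i) (?m (left_normed (x # replicate j y)) y))"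
    \<comment> \<open>The p iterations in the deformation equation correspond to n = p - 1 in
      \<open>fps_ext_funpow_nth_1\<close>.\<close>
    have "Suc (p - 1) = p"
      using assms(2) by simp
    then have "?m x (pmap y) + br x (?w y) = (\<Sum>i\<le>p - 1. ?g i (p - 1 - i))"
      using arg_cong[OF pow[of x y], of "\<lambda>X. X $ 1"]
        fps_ext_funpow_nth_1[OF mt0 m, where x = x and y = y and n = "p - 1"]
      by (simp only: ext1 wt0)
    also have "\<dots> = (\<Sum>(i, j) | i + j = p - 1. ?g i j)"
      \<comment> \<open>A pair with i + j = p - 1 is determined by its first component.\<close>
      by (rule sum.reindex_bij_witness[of _ fst "\<lambda>i. (i, p - 1 - i)"]) auto
    finally show ?thesis
      by (simp add: ind2_def algebra_simps)
  qed
  ultimately show ?thesis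
    using star by (simp add: restricted_2_cocycles_def)
qed

end
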